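(* Let $A\in\mathbb{R}^{n\times n}$ and $B\in\mathbb{R}^{n\times m}$ be such that the pair $(A,B)$ is stabilizable. Let $P$ be the (unique) symmetric positive definite solution $P=P^{T}>0$ of the algebraic Riccati equation $$A^{T}P+PA+I_{n}-PBB^{T}P=0,$$ and let $K:=B^{T}P\in\mathbb{R}^{m\times n}$. Let $\delta>0$ be given. Then for every positive integer $p$ and every connected matrix $\Gamma=[\gamma_{ij}]\in\mathbb{R}^{p\times p}$ with $-\mathrm{Re}(\lambda_{2}(\Gamma))\geq\delta$, the following holds. Consider the $p$ coupled systems $$\dot{x}_{i}=Ax_{i}+Bu_{i},\qquad u_{i}=\max\{1,\delta^{-1}\}\,K z_{i},\qquad z_{i}=\sum_{j=1}^{p}\gamma_{ij}(x_{j}-x_{i}),\qquad i=1,2,\ldots,p,$$ with $x_i(t)\in\mathbb{R}^{n}$, $t\ge 0$. Then for all initial conditions $x_{1}(0),\ldots,x_{p}(0)\in\mathbb{R}^{n}$, the solutions $x_{i}(\cdot)$, $i=1,\ldots,p$, synchronize to $$\bar{x}(t):=(r^{T}\otimes e^{At})\begin{bmatrix}x_{1}(0)\\ \vdots\\ x_{p}(0)\end{bmatrix},$$ i.e. $|x_{i}(t)-\bar{x}(t)|\to 0$ as $t\to\infty$ for all $i$, where $r\in\mathbb{R}^{p}$ satisfies $r^{T}\Gamma=0$ and $r^{T}\mathbf{1}=1$.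
   Context: Notation: $|\cdot|$ is the 2-norm, $\otimes$ is the Kronecker product, $I_n$ is the $n\times n$ identity matrix, and $\mathbf{1}\in\mathbb{R}^{p}$ is the vector with all entries equal to one. A square complex matrix is Hurwitz if all its eigenvalues have strictly negative real parts. The pair $(A,B)$ is stabilizable if there exists $K_0\in\mathbb{R}^{m\times n}$ such that $A-BK_0$ is Hurwitz. When $(A,B)$ is stabilizable, the Riccati equation in the claim is known to have a unique symmetric positive definite solution. Graphs: a (directed) graph is a pair $(\mathcal{N},\mathcal{A})$ with $\mathcal{N}$ a nonempty finite set of nodes and $\mathcal{A}$ a finite collection of ordered pairs (arcs) of nodes. A path from $n_1$ to $n_\ell$ is a sequence of nodes $n_1,n_2,\ldots,n_\ell$ such that $(n_i,n_{i+1})$ is an arc for $i=1,\ldots,\ell-1$. A graph is connected if it has a node to which there exists a path from every other node. The graph of a matrix $\Gamma=[\gamma_{ij}]\in\mathbb{R}^{p\times p}$ has nodes $n_1,\ldots,n_p$, with $(n_i,n_j)$ an arc if and only if $\gamma_{ij}>0$. Connected matrix: $\Gamma=[\gamma_{ij}]\in\mathbb{R}^{p\times p}$ is called connected if (i) $\gamma_{ij}\ge 0$ for $i\ne j$; (ii) each row sum equals $0$; (iii) its graph is connected. It is a known fact that a connected $\Gamma$ has an eigenvalue $0$ (with eigenvector $\mathbf{1}$) and all its other eigenvalues have strictly negative real parts. $\mathrm{Re}(\lambda_{2}(\Gamma))$ denotes the real part of a nonzero eigenvalue of $\Gamma$ closest to the imaginary axis; thus the condition $-\mathrm{Re}(\lambda_2(\Gamma))\ge\delta$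 means that every nonzero eigenvalue $\lambda$ of $\Gamma$ satisfies $\mathrm{Re}(\lambda)\le-\delta$. *)

theory Defs
  imports "HOL-Analysis.Analysis"
begin

text \<open>
  Following \<^theory>\<open>HOL-Analysis.Finite_Cartesian_Product\<close>, a matrix with rows indexed by
  \<open>'m\<close> and columns indexed by \<open>'n\<close> has type \<open>'a ^ 'n ^ 'm\<close>.
\<close>

definition eigenvalue :: "complex ^ 'n ^ 'n \<Rightarrow> complex \<Rightarrow> bool" where
  "eigenvalue M \<mu> \<longleftrightarrow> (\<exists>v. v \<noteq> 0 \<and> M *v v = \<mu> *s v)"

abbreviation cmatrix :: "real ^ 'n ^ 'm \<Rightarrow> complex ^ 'n ^ 'm" where
  "cmatrix \<equiv> map_matrix complex_of_real"

definition hurwitz :: "complex ^ 'n ^ 'n \<Rightarrow> bool" where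
  "hurwitz M \<longleftrightarrow> (\<forall>\<mu>. eigenvalue M \<mu> \<longrightarrow> Re \<mu> < 0)"

definition stabilizable :: "real ^ 'n ^ 'n \<Rightarrow> real ^ 'm ^ 'n \<Rightarrow> bool" where
  "stabilizable A B \<longleftrightarrow> (\<exists>K :: real ^ 'n ^ 'm. hurwitz (cmatrix (A - B ** K)))"

definition sym_pos_def :: "real ^ 'n ^ 'n \<Rightarrow> bool" where
  "sym_pos_def P \<longleftrightarrow> transpose P = P \<and> (\<forall>v. v \<noteq> 0 \<longrightarrow> v \<bullet> (P *v v) > 0)"

text \<open>
  The product \<open>(*)\<close> on vectors and matrices acts componentwise, so neither \<open>(^)\<close> nor
  \<^const>\<open>exp\<close> is available for the matrix product; the exponential is given by its power series.
\<close>

definition matrix_exp :: "real ^ 'n ^ 'n \<Rightarrow> real ^ 'n ^ 'n" where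
  "matrix_exp M = (\<Sum>k. (1 / fact k) *\<^sub>R ((**) M ^^ k) (mat 1))"

text \<open>Rows and columns of a Kronecker product are indexed by pairs (block index, index in block).\<close>

definition kronecker ::
  "real ^ 'b ^ 'a \<Rightarrow> real ^ 'd ^ 'c \<Rightarrow> real ^ ('b \<times> 'd) ^ ('a \<times> 'c)" where
  "kronecker M N = (\<chi> i j. M $ fst i $ fst j * N $ snd i $ snd j)"

definition stack :: "('p::finite \<Rightarrow> real ^ 'n) \<Rightarrow> real ^ ('p \<times> 'n)" where
  "stack x = (\<chi> k. x (fst k) $ snd k)"

text \<open>A vector with a single block, read as that block.\<close>

definition unstack1 :: "real ^ (1 \<times> 'n) \<Rightarrow> real ^ 'n" where
  "unstack1 w = (\<chi> i. w $ (1, i))"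

text \<open>A directed graph is a pair of a set of nodes and a set of arcs.\<close>

definition path_in :: "'a set \<times> ('a \<times> 'a) set \<Rightarrow> 'a list \<Rightarrow> bool" where
  "path_in G ns \<longleftrightarrow>
     ns \<noteq> [] \<and> set ns \<subseteq> fst G \<and> successively (\<lambda>u v. (u, v) \<in> snd G) ns"

definition connected_graph :: "'a set \<times> ('a \<times> 'a) set \<Rightarrow> bool" where
  "connected_graph G \<longleftrightarrow>
     (\<exists>v \<in> fst G. \<forall>u \<in> fst G. u \<noteq> v \<longrightarrow> (\<exists>ns. path_in G ns \<and> hd ns = u \<and> last ns = v))"

definition graph_of_matrix :: "real ^ 'p ^ 'p \<Rightarrow> 'p set \<times> ('p \<times> 'p) set" where
  "graph_of_matrix \<Gamma> = (UNIV, {(i, j). \<Gamma> $ i $ j > 0})"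

definition connected_matrix :: "real ^ 'p ^ 'p \<Rightarrow> bool" where
  "connected_matrix \<Gamma> \<longleftrightarrow>
     (\<forall>i j. i \<noteq> j \<longrightarrow> \<Gamma> $ i $ j \<ge> 0) \<and>
     (\<forall>i. (\<Sum>j\<in>UNIV. \<Gamma> $ i $ j) = 0) \<and>
     connected_graph (graph_of_matrix \<Gamma>)"

end

theory Submission
  imports Defs "HOL-Real_Asymp.Real_Asymp" "HOL-Computational_Algebra.Fundamental_Theorem_Algebra"
begin

text \<open>
  Let \<open>e\<^sub>i = x\<^sub>i - exp (t A) (\<Sum>j. r\<^sub>j x\<^sub>j(0))\<close> and, for a weight vector \<open>w\<close>, \<open>E w = \<Sum>i. w\<^sub>i e\<^sub>i\<close>.
  With \<open>c = max 1 (1/\<delta>)\<close> one has \<open>(E w)' = A (E w) + c B K E(w \<Gamma>)\<close>, and \<open>E r = 0\<close> by uniqueness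
  for linear equations, so only weights whose entries sum to zero matter. If \<open>w \<Gamma> = \<mu> w + s\<close> with
  \<open>Re \<mu> \<le> -\<delta>\<close> and \<open>E s\<close> tends to zero, then \<open>E w\<close> solves a system with matrix \<open>A + c \<mu> B K\<close> and a
  vanishing input; as \<open>1 + 2 c Re \<mu> < 0\<close>, the quadratic form of \<open>P\<close> is a Lyapunov function and \<open>E w\<close>
  tends to zero. Every \<open>w\<close> is annihilated by a polynomial in \<open>\<Gamma>\<close>, so induction on its linear factors
  reaches all weights with zero sum; on these, \<open>\<Gamma>\<close> is injective because it is connected.
\<close>

subsection \<open>Decay estimates\<close>

text \<open>Gronwall's argument: weighting \<open>V t - \<eta>\<close> by
  \<open>exp (\<alpha> * (t - T))\<close> makes it nonincreasing. The sign of
  \<open>\<alpha>\<close> is left open, so that the same estimate serves for decay and for bounded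
  growth.\<close>

lemma exp_weighted_decay:
  fixes V V' :: "real \<Rightarrow> real"
  assumes der: "\<And>t. t \<ge> 0 \<Longrightarrow> (V has_real_derivative V' t) (at t within {0..})"
    and le: "\<And>t. t \<ge> T \<Longrightarrow> V' t \<le> - \<alpha> * (V t - \<eta>)" and "T \<ge> 0" "t \<ge> T"
  shows "V t - \<eta> \<le> (V T - \<eta>) * exp (- \<alpha> * (t - T))"
proof -
  define W where "W t = (V t - \<eta>) * exp (\<alpha> * (t - T))" for t
  have le_T: "W t \<le> W T"
  proof (rule DERIV_nonpos_imp_decreasing_open [OF \<open>t \<ge> T\<close>])
    fix s assume s: "T < s" "s < t"
    \<comment> \<open>Away from the endpoint 0 the one-sided derivative is two-sided;
      \<open>-1\<close> only witnesses that some point lies below 0.\<close>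
    then have "(V has_real_derivative V' s) (at s)"
      using der[of s] \<open>T \<ge> 0\<close> at_within_interior[of s "{0..}"] by (simp add: interior_Ici[where b = "-1"])
    then have "(W has_real_derivative (V' s + \<alpha> * (V s - \<eta>)) * exp (\<alpha> * (s - T))) (at s)"
      unfolding W_def by (auto intro!: derivative_eq_intros simp: algebra_simps)
    moreover have "(V' s + \<alpha> * (V s - \<eta>)) * exp (\<alpha> * (s - T)) \<le> 0"
      using le[of s] s by (auto intro!: mult_nonpos_nonneg)
    ultimately show "\<exists>y. (W has_real_derivative y) (at s) \<and> y \<le> 0" by blast
  next
    have "continuous_on {0..} V"
      using der by (auto intro!: DERIV_continuous_on)
    then show "continuous_on {T..t} W"
      unfolding W_def using \<open>T \<ge> 0\<close>
      by (intro continuous_intros) (auto elim: continuous_on_subset)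
  qed
  have "V t - \<eta> = W t * exp (- \<alpha> * (t - T))"
    by (simp add: W_def mult.assoc flip: exp_add)
  also have "\<dots> \<le> W T * exp (- \<alpha> * (t - T))"
    using le_T by (intro mult_right_mono) auto
  also have "W T = V T - \<eta>" by (simp add: W_def)
  finally show ?thesis .
qed

text \<open>Once the input stays below \<open>\<alpha> * (e / 2)\<close>, shifting \<open>V\<close>
  by \<open>e / 2\<close> absorbs it, and the exponential estimate brings \<open>V\<close> below
  \<open>e\<close>.\<close>

lemma perturbed_decay_tendsto_zero:
  fixes V V' :: "real \<Rightarrow> real"
  assumes der: "\<And>t. t \<ge> 0 \<Longrightarrow> (V has_real_derivative V' t) (at t within {0..})"
    and le: "\<And>t. t \<ge> 0 \<Longrightarrow> V' t \<le> - \<alpha> * V t + \<epsilon> t"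
    and \<alpha>: "\<alpha> > 0" and nonneg: "\<And>t. V t \<ge> 0" and \<epsilon>: "(\<epsilon> \<longlongrightarrow> 0) at_top"
  shows "(V \<longlongrightarrow> 0) at_top"
proof (rule tendstoI)
  fix e :: real assume "e > 0"
  have "\<forall>\<^sub>F t in at_top. \<epsilon> t < \<alpha> * (e / 2) \<and> t \<ge> 0"
    using order_tendstoD(2)[OF \<epsilon>, of "\<alpha> * (e / 2)"] \<open>e > 0\<close> \<alpha>
    by (auto intro: eventually_conj eventually_ge_at_top)
  then obtain T where T: "\<And>t. t \<ge> T \<Longrightarrow> \<epsilon> t < \<alpha> * (e / 2) \<and> t \<ge> 0"
    by (auto simp: eventually_at_top_linorder)
  have bound: "V t - e / 2 \<le> (V T - e / 2) * exp (- \<alpha> * (t - T))" if "t \<ge> T" for t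
  proof (rule exp_weighted_decay [OF der])
    show "V' s \<le> - \<alpha> * (V s - e / 2)" if "s \<ge> T" for s
      using le[of s] T[OF that] by (simp add: algebra_simps)
  qed (use T that in auto)
  have "((\<lambda>t. (V T - e / 2) * exp (- \<alpha> * (t - T))) \<longlongrightarrow> 0) at_top"
    using \<alpha> by real_asymp
  then have "\<forall>\<^sub>F t in at_top. (V T - e / 2) * exp (- \<alpha> * (t - T)) < e / 2"
    using \<open>e > 0\<close> by (auto dest: order_tendstoD(2)[where a = "e / 2"])
  then show "\<forall>\<^sub>F t in at_top. dist (V t) 0 < e"
    using eventually_ge_at_top[of T]
  proof eventually_elim
    case (elim t)
    then show ?case using bound[of t] nonneg[of t] by (simp add: dist_real_def)
  qed
qed

lemma linear_ode_unique_zero: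
  fixes y :: "real \<Rightarrow> 'a::euclidean_space"
  assumes "linear f"
    and der: "\<And>t. t \<ge> 0 \<Longrightarrow> (y has_vector_derivative f (y t)) (at t within {0..})"
    and "y 0 = 0" "t \<ge> 0"
  shows "y t = 0"
proof -
  obtain L where L: "\<And>v. norm (f v) \<le> L * norm v"
    using linear_bounded[OF \<open>linear f\<close>] by blast
  \<comment> \<open>The squared norm grows at rate at most \<open>2 * L\<close>, so the estimate is
    used with \<open>\<alpha> = -2 * L\<close> and starts from the value zero.\<close>
  have "(y t \<bullet> y t) - 0 \<le> (y 0 \<bullet> y 0 - 0) * exp (- (-2 * L) * (t - 0))"
  proof (rule exp_weighted_decay [where V = "\<lambda>t. y t \<bullet> y t" and V' = "\<lambda>t. 2 * (y t \<bullet> f (y t))"])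
    show "((\<lambda>t. y t \<bullet> y t) has_real_derivative 2 * (y s \<bullet> f (y s))) (at s within {0..})"
      if "s \<ge> 0" for s
      using der[OF that] unfolding has_vector_derivative_def has_field_derivative_def
      by (auto intro!: derivative_eq_intros simp: algebra_simps inner_commute)
    show "2 * (y s \<bullet> f (y s)) \<le> - (-2 * L) * (y s \<bullet> y s - 0)" for s
    proof -
      have "y s \<bullet> f (y s) \<le> norm (y s) * norm (f (y s))" by (rule norm_cauchy_schwarz)
      also have "\<dots> \<le> norm (y s) * (L * norm (y s))" by (intro mult_left_mono L) simp
      finally show ?thesis by (simp add: dot_square_norm power2_eq_square mult_ac)
    qed
  qed (use \<open>t \<ge> 0\<close> in auto)
  then show ?thesis using \<open>y 0 = 0\<close>
    by (metis diff_zero inner_eq_zero_iff inner_ge_zero mult_zero_left order_antisym_conv)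
qed

section \<open>Quadratic form of \<open>P\<close> and the Riccati equation\<close>

lemma sym_pos_def_bounds:
  fixes P :: "real ^ 'n ^ 'n"
  assumes "sym_pos_def P"
  obtains m M where "m > 0" "M > 0"
    "\<And>v. m * (v \<bullet> v) \<le> v \<bullet> (P *v v)" "\<And>v. v \<bullet> (P *v v) \<le> M * (v \<bullet> v)"
    "\<And>v. norm (P *v v) \<le> M * norm v"
proof -
  have pos: "v \<bullet> (P *v v) > 0" if "v \<noteq> 0" for v
    using assms that by (simp add: sym_pos_def_def)
  obtain L where L: "L > 0" "\<And>v. norm (P *v v) \<le> norm v * L"
    using bounded_linear.pos_bounded[OF matrix_vector_mul_bounded_linear[of P]] by blast
  \<comment> \<open>The lower constant is the minimum of the form on the compact unit sphere,
    attained at \<open>v0\<close>; homogeneity extends the bound to all vectors.\<close>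
  have "continuous_on (sphere 0 1) (\<lambda>v. v \<bullet> (P *v v))"
    by (intro continuous_intros linear_continuous_on matrix_vector_mul_bounded_linear)
  moreover have "sphere (0::real^'n) 1 \<noteq> {}" by simp
  ultimately obtain v0 where v0: "v0 \<in> sphere 0 1"
    "\<And>v. v \<in> sphere 0 1 \<Longrightarrow> v0 \<bullet> (P *v v0) \<le> v \<bullet> (P *v v)"
    using continuous_attains_inf[OF compact_sphere] by blast
  show ?thesis
  proof
    show "v0 \<bullet> (P *v v0) > 0" using v0(1) pos[of v0] by force
    show "(v0 \<bullet> (P *v v0)) * (v \<bullet> v) \<le> v \<bullet> (P *v v)" for v
    proof (cases "v = 0")
      case False
      let ?u = "inverse (norm v) *\<^sub>R v"
      have "v0 \<bullet> (P *v v0) \<le> ?u \<bullet> (P *v ?u)" using False by (intro v0) simp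
      also have "\<dots> = (v \<bullet> (P *v v)) / (v \<bullet> v)"
        by (simp add: matrix_vector_mult_scaleR dot_square_norm power2_eq_square field_simps)
      finally show ?thesis using False by (simp add: field_simps)
    qed simp
    show "v \<bullet> (P *v v) \<le> L * (v \<bullet> v)" for v
    proof -
      have "v \<bullet> (P *v v) \<le> norm v * norm (P *v v)" by (rule norm_cauchy_schwarz)
      also have "\<dots> \<le> norm v * (norm v * L)" by (intro mult_left_mono L) simp
      finally show ?thesis by (simp add: dot_square_norm power2_eq_square mult_ac)
    qed
  qed (use L in \<open>auto simp: mult_ac\<close>)
qed

lemma inner_transpose_matrix_vector:
  fixes M :: "real ^ 'a ^ 'b"
  shows "x \<bullet> (transpose M *v y) = (M *v x) \<bullet> y"
  by (metis dot_lmul_matrix inner_commute transpose_matrix_vector)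

text \<open>The Riccati equation read as a quadratic form at \<open>v\<close>: by symmetry of
  \<open>P\<close> its first two terms contribute equally, and the last one is a squared norm. The
  left side is the derivative of the form of \<open>P\<close> along the flow of
  \<open>A\<close>.\<close>

lemma riccati_quadratic:
  fixes A P :: "real ^ 'n ^ 'n" and B :: "real ^ 'm ^ 'n"
  assumes "transpose P = P"
    and "transpose A ** P + P ** A + mat 1 - P ** B ** transpose B ** P = 0"
  shows "2 * (v \<bullet> (P *v (A *v v))) =
    (transpose B ** P *v v) \<bullet> (transpose B ** P *v v) - v \<bullet> v"
proof -
  have P: "x \<bullet> (P *v y) = (P *v x) \<bullet> y" for x y
    using inner_transpose_matrix_vector[of x P y] assms(1) by simp
  have "0 = v \<bullet> ((transpose A ** P + P ** A + mat 1 - P ** B ** transpose B ** P) *v v)"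
    using assms(2) by simp
  also have "\<dots> = v \<bullet> (transpose A *v (P *v v)) + v \<bullet> (P *v (A *v v)) + v \<bullet> v
      - v \<bullet> (P *v (B *v (transpose B *v (P *v v))))"
    by (simp add: matrix_vector_mult_add_rdistrib matrix_vector_mult_diff_rdistrib inner_add_right
        inner_diff_right del: transpose_matrix_vector flip: matrix_vector_mul_assoc)
  also have "v \<bullet> (transpose A *v (P *v v)) = v \<bullet> (P *v (A *v v))"
    using inner_transpose_matrix_vector[of v A "P *v v"] P[of v "A *v v"] by (simp only: inner_commute)
  also have "v \<bullet> (P *v (B *v (transpose B *v (P *v v)))) =
      (transpose B *v (P *v v)) \<bullet> (transpose B *v (P *v v))"
    using inner_transpose_matrix_vector[of "transpose B *v (P *v v)" B "P *v v"]
      P[of v "B *v (transpose B *v (P *v v))"]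
    by (simp only: inner_commute)
  finally show ?thesis by (simp del: transpose_matrix_vector flip: matrix_vector_mul_assoc)
qed

text \<open>Here \<open>a\<close> and \<open>b\<close> are the real and imaginary parts of a complex
  solution for the matrix \<open>A + (\<sigma> + i \<omega>) B K\<close> with vanishing input
  \<open>g + i h\<close>. The sum of the forms of \<open>P\<close> at \<open>a\<close> and
  \<open>b\<close> is a Lyapunov function, because \<open>1 + 2 * \<sigma>\<close> is not
  positive.\<close>

lemma riccati_block_tendsto_zero:
  fixes A P :: "real ^ 'n ^ 'n" and B :: "real ^ 'm ^ 'n" and a b g h :: "real \<Rightarrow> real ^ 'n"
  assumes P: "sym_pos_def P"
    and ric: "transpose A ** P + P ** A + mat 1 - P ** B ** transpose B ** P = 0"
    and K: "K = transpose B ** P"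
    and \<sigma>: "2 * \<sigma> \<le> -1"
    and da: "\<And>t. t \<ge> 0 \<Longrightarrow> (a has_vector_derivative
      A *v a t + B *v (K *v (\<sigma> *\<^sub>R a t - \<omega> *\<^sub>R b t)) + g t) (at t within {0..})"
    and db: "\<And>t. t \<ge> 0 \<Longrightarrow> (b has_vector_derivative
      A *v b t + B *v (K *v (\<sigma> *\<^sub>R b t + \<omega> *\<^sub>R a t)) + h t) (at t within {0..})"
    and g: "(g \<longlongrightarrow> 0) at_top" and h: "(h \<longlongrightarrow> 0) at_top"
  shows "(a \<longlongrightarrow> 0) at_top \<and> (b \<longlongrightarrow> 0) at_top"
proof -
  have symP: "transpose P = P" using P by (simp add: sym_pos_def_def)
  obtain m M where mM: "m > 0" "M > 0" "\<And>v. m * (v \<bullet> v) \<le> v \<bullet> (P *v v)"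
    "\<And>v. v \<bullet> (P *v v) \<le> M * (v \<bullet> v)" "\<And>v. norm (P *v v) \<le> M * norm v"
    using sym_pos_def_bounds[OF P] by blast
  have sym: "x \<bullet> (P *v y) = y \<bullet> (P *v x)" for x y
    by (metis dot_lmul_matrix inner_commute symP transpose_matrix_vector)
  have PB: "x \<bullet> (P *v (B *v y)) = (K *v x) \<bullet> y" for x y
    unfolding K
    by (metis dot_lmul_matrix inner_commute matrix_vector_mul_assoc sym transpose_matrix_vector)
  have nonneg: "0 \<le> v \<bullet> (P *v v)" for v
  proof -
    have "0 \<le> m * (v \<bullet> v)" using mM(1) by simp
    then show ?thesis using mM(3)[of v] by linarith
  qed
  define V where "V t = a t \<bullet> (P *v a t) + b t \<bullet> (P *v b t)" for t
  define a' where "a' t = A *v a t + B *v (K *v (\<sigma> *\<^sub>R a t - \<omega> *\<^sub>R b t)) + g t" for t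
  define b' where "b' t = A *v b t + B *v (K *v (\<sigma> *\<^sub>R b t + \<omega> *\<^sub>R a t)) + h t" for t
  define V' where "V' t = 2 * (a t \<bullet> (P *v a' t)) + 2 * (b t \<bullet> (P *v b' t))" for t
  define \<epsilon> where "\<epsilon> t = 2 * M\<^sup>2 * ((norm (g t))\<^sup>2 + (norm (h t))\<^sup>2)" for t
  \<comment> \<open>Young's inequality, weighted so that the input consumes only half of the
    available decay \<open>v \<bullet> v\<close>.\<close>
  have young: "2 * (v \<bullet> (P *v w)) \<le> (v \<bullet> v) / 2 + 2 * M\<^sup>2 * (norm w)\<^sup>2" for v w
  proof -
    have "v \<bullet> (P *v w) \<le> norm v * norm (P *v w)" by (rule norm_cauchy_schwarz)
    also have "\<dots> \<le> norm v * (M * norm w)" by (intro mult_left_mono mM) simp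
    finally have "2 * (v \<bullet> (P *v w)) \<le> 2 * (norm v * (M * norm w))" by simp
    moreover have "0 \<le> (norm v - 2 * (M * norm w))\<^sup>2" by simp
    ultimately show ?thesis
      by (simp add: dot_square_norm power2_eq_square algebra_simps)
  qed
  have V: "(V \<longlongrightarrow> 0) at_top"
  proof (rule perturbed_decay_tendsto_zero)
    fix t :: real assume t: "t \<ge> 0"
    have PD: "((\<lambda>t. P *v y t) has_vector_derivative P *v y') (at t within {0..})"
      if "(y has_vector_derivative y') (at t within {0..})" for y y'
      using bounded_linear.has_vector_derivative[OF matrix_vector_mul_bounded_linear that] .
    have q: "((\<lambda>t. y t \<bullet> (P *v y t)) has_real_derivative 2 * (y t \<bullet> (P *v y'))) (at t within {0..})"
      if "(y has_vector_derivative y') (at t within {0..})" for y y'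
      using bounded_bilinear.has_vector_derivative[OF bounded_bilinear_inner that PD[OF that]]
      unfolding has_real_derivative_iff_has_vector_derivative
      by (simp add: sym[of y'])
    show "(V has_real_derivative V' t) (at t within {0..})"
      unfolding V_def V'_def a'_def b'_def using q[OF da[OF t]] q[OF db[OF t]] by (rule DERIV_add)
    have quad: "2 * (v \<bullet> (P *v (A *v v))) = (K *v v) \<bullet> (K *v v) - v \<bullet> v" for v
      using riccati_quadratic[OF symP ric] K by simp
    \<comment> \<open>The two terms with \<open>\<omega>\<close> are opposite multiples of the inner
      product of \<open>K *v a t\<close> and \<open>K *v b t\<close>, and cancel.\<close>
    have "V' t = ((K *v a t) \<bullet> (K *v a t) - a t \<bullet> a t) + ((K *v b t) \<bullet> (K *v b t) - b t \<bullet> b t)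
       + 2 * \<sigma> * ((K *v a t) \<bullet> (K *v a t) + (K *v b t) \<bullet> (K *v b t))
       + 2 * (a t \<bullet> (P *v g t)) + 2 * (b t \<bullet> (P *v h t))"
      unfolding V'_def a'_def b'_def quad [symmetric]
      by (simp add: matrix_vector_right_distrib PB inner_add_right matrix_vector_mult_diff_distrib
          matrix_vector_mult_scaleR inner_diff_right inner_commute[of "K *v b t" "K *v a t"] algebra_simps)
    also have "\<dots> = (1 + 2 * \<sigma>) * ((K *v a t) \<bullet> (K *v a t) + (K *v b t) \<bullet> (K *v b t))
       - (a t \<bullet> a t + b t \<bullet> b t) + 2 * (a t \<bullet> (P *v g t)) + 2 * (b t \<bullet> (P *v h t))"
      by (simp add: algebra_simps)
    also have "\<dots> \<le> 0 - (a t \<bullet> a t + b t \<bullet> b t)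
        + ((a t \<bullet> a t) / 2 + 2 * M\<^sup>2 * (norm (g t))\<^sup>2) + ((b t \<bullet> b t) / 2 + 2 * M\<^sup>2 * (norm (h t))\<^sup>2)"
      using \<sigma> by (intro add_mono diff_mono young order_refl mult_nonpos_nonneg) auto
    also have "\<dots> = - (a t \<bullet> a t + b t \<bullet> b t) / 2 + \<epsilon> t"
      by (simp add: \<epsilon>_def field_simps)
    \<comment> \<open>The upper bound on the form of \<open>P\<close> turns the remaining half of
      the decay into a multiple of \<open>V\<close>.\<close>
    also have "\<dots> \<le> - (1 / (2 * M)) * V t + \<epsilon> t"
      using mM(4)[of "a t"] mM(4)[of "b t"] mM(2) by (simp add: V_def field_simps)
    finally show "V' t \<le> - (1 / (2 * M)) * V t + \<epsilon> t" .
  next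
    show "V t \<ge> 0" for t
      using nonneg[of "a t"] nonneg[of "b t"] by (simp add: V_def)
    show "(\<epsilon> \<longlongrightarrow> 0) at_top"
      unfolding \<epsilon>_def using g h by (auto intro!: tendsto_eq_intros)
  qed (use mM in auto)
  have *: "(y \<longlongrightarrow> 0) at_top"
    if "\<And>t. y t \<bullet> (P *v y t) \<le> V t" for y :: "real \<Rightarrow> real ^ 'n"
  proof -
    have "((\<lambda>t. sqrt (V t / m)) \<longlongrightarrow> 0) at_top"
      using tendsto_real_sqrt[OF tendsto_divide[OF V tendsto_const, of m]] mM(1) by simp
    moreover have "norm (y t) \<le> sqrt (V t / m)" for t
      using order_trans[OF mM(3)[of "y t"] that[of t]] mM(1)
      by (simp add: norm_eq_sqrt_inner field_simps)
    ultimately show ?thesis by (intro Lim_null_comparison[of y]) auto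
  qed
  then show ?thesis using nonneg by (auto intro!: * simp: V_def)
qed

subsection \<open>The matrix exponential\<close>

text \<open>Geometric growth, which lets a scalar exponential series dominate the matrix series. The
  factor \<open>norm (mat 1)\<close> appears because the norm of a matrix here is Euclidean, so the
  identity need not have norm one.\<close>

lemma matrix_power_norm_bound:
  fixes A :: "real ^ 'n ^ 'n"
  obtains L where "\<And>k. norm (((**) A ^^ k) (mat 1)) \<le> norm (mat 1 :: real ^ 'n ^ 'n) * L ^ k"
proof -
  have "linear ((**) A :: real ^ 'n ^ 'n \<Rightarrow> _)"
    by (rule linearI) (simp_all add: matrix_add_ldistrib matrix_scalar_ac scalar_matrix_assoc)
  then obtain L where L: "L > 0" "\<And>X :: real ^ 'n ^ 'n. norm (A ** X) \<le> L * norm X"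
    using linear_bounded_pos by blast
  have "norm (((**) A ^^ k) (mat 1)) \<le> norm (mat 1 :: real ^ 'n ^ 'n) * L ^ k" for k
  proof (induction k)
    case (Suc k)
    have "norm (((**) A ^^ Suc k) (mat 1)) \<le> L * norm (((**) A ^^ k) (mat 1))" by (simp add: L)
    also have "\<dots> \<le> L * (norm (mat 1 :: real ^ 'n ^ 'n) * L ^ k)"
      using L Suc by (intro mult_left_mono) auto
    finally show ?case by (simp add: mult_ac)
  qed simp
  then show ?thesis by (rule that)
qed

lemma matrix_power_scaleR:
  fixes A :: "real ^ 'n ^ 'n"
  shows "((**) (t *\<^sub>R A) ^^ k) (mat 1) = t ^ k *\<^sub>R ((**) A ^^ k) (mat 1)"
  by (induction k) (simp_all add: matrix_scalar_ac flip: scalar_matrix_assoc)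

lemma summable_matrix_exp:
  fixes A :: "real ^ 'n ^ 'n"
  shows "summable (\<lambda>k. (1 / fact k) *\<^sub>R ((**) (t *\<^sub>R A) ^^ k) (mat 1))"
proof -
  obtain L where L: "\<And>k. norm (((**) (t *\<^sub>R A) ^^ k) (mat 1)) \<le> norm (mat 1 :: real ^ 'n ^ 'n) * L ^ k"
    using matrix_power_norm_bound by blast
  have "summable (\<lambda>k. norm (mat 1 :: real ^ 'n ^ 'n) * (inverse (fact k) * L ^ k))"
    by (intro summable_mult summable_exp)
  then show ?thesis
    by (rule summable_comparison_test') (use L in \<open>simp add: field_simps\<close>)
qed

lemma bounded_linear_entry: "bounded_linear (\<lambda>M :: real ^ 'm ^ 'n. M $ i $ j)"
  by (intro bounded_linear_compose[of "\<lambda>v. v $ j" "\<lambda>M. M $ i"] bounded_linear_vec_nth)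

text \<open>Presents each entry as a scalar power series in \<open>t\<close>, ready for termwise
  differentiation.\<close>

lemma matrix_exp_entry:
  fixes A :: "real ^ 'n ^ 'n"
  shows "(\<lambda>k. (((**) A ^^ k) (mat 1) $ i $ j / fact k) * t ^ k) sums (matrix_exp (t *\<^sub>R A) $ i $ j)"
proof -
  have "(\<lambda>k. (1 / fact k) *\<^sub>R ((**) (t *\<^sub>R A) ^^ k) (mat 1)) sums matrix_exp (t *\<^sub>R A)"
    unfolding matrix_exp_def by (rule summable_sums [OF summable_matrix_exp])
  from bounded_linear.sums [OF bounded_linear_entry[of i j] this]
  show ?thesis by (simp add: matrix_power_scaleR mult_ac)
qed

lemma matrix_exp_entry_derivative:
  fixes A :: "real ^ 'n ^ 'n"
  shows "((\<lambda>t. matrix_exp (t *\<^sub>R A) $ i $ j) has_real_derivative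
    (A ** matrix_exp (t *\<^sub>R A)) $ i $ j) (at t)"
proof -
  define c where "c i j k = ((**) A ^^ k) (mat 1) $ i $ j / fact k" for i j k
  have sums: "(\<lambda>k. c i j k * t ^ k) sums (matrix_exp (t *\<^sub>R A) $ i $ j)" for i j t
    unfolding c_def by (rule matrix_exp_entry)
  have "((\<lambda>t. \<Sum>k. c i j k * t ^ k) has_real_derivative (\<Sum>k. diffs (c i j) k * t ^ k)) (at t)"
    by (rule termdiffs_strong_converges_everywhere) (rule sums_summable [OF sums])
  \<comment> \<open>Differentiation shifts the index and cancels one factor of the factorial; what
    remains of the shift is one more factor \<open>A\<close> on the left.\<close>
  moreover have "diffs (c i j) k = (\<Sum>l\<in>UNIV. A $ i $ l * c l j k)" for k
  proof -
    have "diffs (c i j) k = (A ** ((**) A ^^ k) (mat 1)) $ i $ j / fact k"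
      by (simp add: diffs_def c_def field_simps del: of_nat_Suc)
    then show ?thesis
      by (simp add: matrix_matrix_mult_def c_def sum_divide_distrib)
  qed
  moreover have "(\<lambda>k. (\<Sum>l\<in>UNIV. A $ i $ l * c l j k) * t ^ k) sums
      (\<Sum>l\<in>UNIV. A $ i $ l * matrix_exp (t *\<^sub>R A) $ l $ j)"
    unfolding sum_distrib_right mult.assoc by (intro sums_sum sums_mult sums)
  ultimately show ?thesis
    by (simp add: sums_iff [THEN iffD1, OF sums] sums_iff matrix_matrix_mult_def)
qed

lemma matrix_exp_vector_derivative:
  fixes A :: "real ^ 'n ^ 'n"
  shows "((\<lambda>t. matrix_exp (t *\<^sub>R A) *v v) has_vector_derivative
    A *v (matrix_exp (t *\<^sub>R A) *v v)) (at t within S)"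
proof -
  have "((\<lambda>t. (matrix_exp (t *\<^sub>R A) *v v) $ i) has_real_derivative
      ((A ** matrix_exp (t *\<^sub>R A)) *v v) $ i) (at t)" for i
    unfolding matrix_vector_mult_def[of _ v] vec_lambda_beta
    by (intro DERIV_sum DERIV_cmult_right matrix_exp_entry_derivative)
  then have "((\<lambda>t. (matrix_exp (t *\<^sub>R A) *v v) $ i) has_real_derivative
      ((A ** matrix_exp (t *\<^sub>R A)) *v v) $ i) (at t within S)" for i
    by (rule has_field_derivative_at_within)
  then show ?thesis
    unfolding has_vector_derivative_def
    by (subst has_derivative_componentwise_within)
      (auto simp: Basis_vec_def inner_axis has_field_derivative_def matrix_vector_mul_assoc
        mult_commute_abs)
qed

lemma matrix_exp_0: "matrix_exp (0 :: real ^ 'n ^ 'n) = mat 1"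
proof -
  have "(1 / fact k) *\<^sub>R ((**) (0 :: real ^ 'n ^ 'n) ^^ k) (mat 1) = (if k = 0 then mat 1 else 0)" for k
    by (cases k) (simp_all add: matrix_matrix_mult_def vec_eq_iff)
  then show ?thesis
    unfolding matrix_exp_def by (subst suminf_finite[of "{0}"]) auto
qed

text \<open>Identifies the target trajectory as \<open>M\<close>, later the matrix exponential,
  applied to the \<open>r\<close>-weighted mean of the initial states.\<close>

lemma unstack1_kronecker_rowvector:
  fixes r :: "real ^ 'p" and M :: "real ^ 'n ^ 'n"
  shows "unstack1 (kronecker (rowvector r :: real ^ 'p ^ 1) M *v stack y) =
    M *v (\<Sum>i\<in>UNIV. r $ i *\<^sub>R y i)"
proof (rule vec_eq_iff [THEN iffD2], rule allI)
  fix a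
  have "unstack1 (kronecker (rowvector r :: real ^ 'p ^ 1) M *v stack y) $ a =
      (\<Sum>k\<in>UNIV \<times> UNIV. r $ fst k * M $ a $ snd k * y (fst k) $ snd k)"
    by (simp add: unstack1_def kronecker_def rowvector_def stack_def matrix_vector_mult_def)
  also have "\<dots> = (\<Sum>i\<in>UNIV. \<Sum>b\<in>UNIV. r $ i * M $ a $ b * y i $ b)"
    by (simp add: sum.cartesian_product case_prod_beta)
  also have "\<dots> = (\<Sum>b\<in>UNIV. \<Sum>i\<in>UNIV. r $ i * M $ a $ b * y i $ b)" by (rule sum.swap)
  also have "\<dots> = (M *v (\<Sum>i\<in>UNIV. r $ i *\<^sub>R y i)) $ a"
    by (simp add: matrix_vector_mult_def sum_distrib_left mult_ac)
  finally show "unstack1 (kronecker (rowvector r :: real ^ 'p ^ 1) M *v stack y) $ a =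
    (M *v (\<Sum>i\<in>UNIV. r $ i *\<^sub>R y i)) $ a" .
qed

subsection \<open>Kernels and spectral induction\<close>

lemma successively_invariant:
  assumes "successively R ns" "ns \<noteq> []" "Q (hd ns)" "\<And>u w. R u w \<Longrightarrow> Q u \<Longrightarrow> Q w"
  shows "Q (last ns)"
  using assms(1-3)
proof (induction ns rule: induct_list012)
  case (3 u w ns)
  then have "Q w" using assms(4)[of u w] by simp
  then show ?case using 3 by simp
qed auto

text \<open>A maximum principle: where \<open>v\<close> attains its maximum, the zero row sum forces
  the same value at every out-neighbour, and a path carries it to the root \<open>q\<close>. Applied
  to \<open>v\<close> and \<open>- v\<close>, this makes every entry equal to the one at
  \<open>q\<close>.\<close>

lemma connected_matrix_kernel:
  fixes \<Gamma> :: "real ^ 'p ^ 'p"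
  assumes con: "connected_matrix \<Gamma>" and ker: "\<Gamma> *v v = 0"
  shows "\<exists>a. \<forall>i. v $ i = a"
proof -
  obtain q where q: "\<And>u. u \<noteq> q \<Longrightarrow> \<exists>ns. path_in (graph_of_matrix \<Gamma>) ns \<and> hd ns = u \<and> last ns = q"
    using con by (auto simp: connected_matrix_def connected_graph_def graph_of_matrix_def)
  have nonneg: "i \<noteq> j \<Longrightarrow> \<Gamma> $ i $ j \<ge> 0" and row: "(\<Sum>j\<in>UNIV. \<Gamma> $ i $ j) = 0" for i j
    using con by (auto simp: connected_matrix_def)
  have le_root: "v $ i \<le> v $ q" if ker: "\<Gamma> *v v = 0" for v :: "real ^ 'p" and i
  proof -
    obtain k where k: "\<And>i. v $ i \<le> v $ k"
      using Max_in[of "range (($) v)"] Max_ge[of "range (($) v)"] by fastforce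
    have step: "v $ j = v $ k" if "\<Gamma> $ i $ j > 0" "v $ i = v $ k" for i j
    proof -
      have "0 = (\<Gamma> *v v) $ i - v $ i * (\<Sum>j\<in>UNIV. \<Gamma> $ i $ j)" by (simp add: ker row)
      also have "\<dots> = - (\<Sum>j\<in>UNIV. \<Gamma> $ i $ j * (v $ k - v $ j))"
        by (simp add: matrix_vector_mult_def right_diff_distrib sum_subtractf sum_distrib_left
            that(2) mult_ac)
      finally have "(\<Sum>j\<in>UNIV. \<Gamma> $ i $ j * (v $ k - v $ j)) = 0" by simp
      \<comment> \<open>The diagonal entry may be negative, but its factor vanishes because
        \<open>v $ i = v $ k\<close>.\<close>
      moreover have "\<Gamma> $ i $ j * (v $ k - v $ j) \<ge> 0" for j
        using nonneg[of i j] k[of j] that(2) by (cases "i = j") auto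
      ultimately have "\<Gamma> $ i $ j * (v $ k - v $ j) = 0"
        by (subst (asm) sum_nonneg_eq_0_iff) auto
      then show ?thesis using that by simp
    qed
    have "v $ q = v $ k"
    proof (cases "k = q")
      case False
      then obtain ns where "path_in (graph_of_matrix \<Gamma>) ns" "hd ns = k" "last ns = q"
        using q by blast
      then show ?thesis
        using successively_invariant[of "\<lambda>i j. \<Gamma> $ i $ j > 0" ns "\<lambda>i. v $ i = v $ k"] step
        by (auto simp: path_in_def graph_of_matrix_def)
    qed simp
    then show ?thesis using k by simp
  qed
  have "\<Gamma> *v (- v) = 0" using ker matrix_vector_mult_diff_distrib[of \<Gamma> 0 v] by simp
  then have "v $ i = v $ q" for i
    using le_root[OF ker, of i] le_root[of "- v" i] by simp
  then show ?thesis by blast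
qed

text \<open>For a square matrix, injectivity gives a left inverse, which is also a right
  inverse.\<close>

lemma left_kernel_trivial:
  fixes M :: "'a::field ^ 'n ^ 'n"
  assumes "\<And>v. M *v v = 0 \<Longrightarrow> v = 0" and "w v* M = 0"
  shows "w = 0"
proof -
  obtain N where "N ** M = mat 1"
    using assms(1) matrix_left_invertible_ker[of M] by auto
  then have "M ** N = mat 1" by (rule matrix_left_right_inverse1)
  then have "w = (w v* M) v* N" by (simp add: vector_matrix_mul_assoc)
  then show ?thesis using assms(2) by simp
qed

text \<open>A rank-one update: with all rows of \<open>R\<close> equal to \<open>r\<close>, the
  matrix \<open>\<Gamma> + R\<close> is injective, while \<open>w\<close> annihilates both summands
  from the left. Pairing a kernel vector with \<open>r\<close> removes \<open>\<Gamma>\<close>, and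
  the kernel of \<open>\<Gamma>\<close> contains only constant vectors.\<close>

lemma connected_matrix_left_kernel:
  fixes \<Gamma> :: "real ^ 'p ^ 'p"
  assumes con: "connected_matrix \<Gamma>" and r: "r v* \<Gamma> = 0" "(\<Sum>i\<in>UNIV. r $ i) = 1"
    and w: "w v* \<Gamma> = 0" "(\<Sum>i\<in>UNIV. w $ i) = 0"
  shows "w = 0"
proof (rule left_kernel_trivial)
  define R :: "real ^ 'p ^ 'p" where "R = (\<chi> i. r)"
  have R: "R *v v = (\<chi> i. r \<bullet> v)" for v
    by (simp add: R_def matrix_vector_mult_def inner_vec_def)
  show "v = 0" if "(\<Gamma> + R) *v v = 0" for v
  proof -
    have "0 = r \<bullet> (\<Gamma> *v v) + r \<bullet> (\<chi> i. r \<bullet> v)"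
      using that by (metis R inner_add_right inner_zero_right matrix_vector_mult_add_rdistrib)
    also have "r \<bullet> (\<Gamma> *v v) = 0" using r(1) by (metis dot_lmul_matrix inner_zero_left)
    also have "r \<bullet> (\<chi> i. r \<bullet> v) = r \<bullet> v"
      using r(2) by (simp add: inner_vec_def[of r "\<chi> i. _"] flip: sum_distrib_right)
    finally have rv: "r \<bullet> v = 0" by simp
    then have "\<Gamma> *v v = 0" using that by (simp add: matrix_vector_mult_add_rdistrib R vec_eq_iff)
    then obtain a where a: "\<And>i. v $ i = a" using connected_matrix_kernel[OF con] by blast
    then have "r \<bullet> v = a" using r(2) by (simp add: inner_vec_def flip: sum_distrib_right)
    then show ?thesis using a rv by (simp add: vec_eq_iff)
  qed
  have "w v* R = 0"
    using w(2) by (simp add: R_def vector_matrix_mult_def vec_eq_iff flip: sum_distrib_right)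
  then show "w v* (\<Gamma> + R) = 0"
    using w(1) by (simp add: vector_matrix_mult_add_rdistrib)
qed

text \<open>Eigenvalues are defined by right eigenvectors, whereas weights are multiplied from the
  left; for \<open>M - mat \<mu>\<close> the two kernels are trivial together.\<close>

lemma not_eigenvalue_left_trivial:
  assumes "\<not> eigenvalue M \<mu>" "w v* M = \<mu> *s w"
  shows "w = 0"
proof (rule left_kernel_trivial)
  have mat: "mat \<mu> *v v = \<mu> *s v" "v v* mat \<mu> = \<mu> *s v" for v
    by (simp_all add: matrix_vector_mult_def vector_matrix_mult_def mat_def vec_eq_iff
        if_distrib if_distribR sum.delta' cong: if_cong)
  show "v = 0" if "(M - mat \<mu>) *v v = 0" for v
    using assms(1) that by (auto simp: eigenvalue_def matrix_vector_mult_diff_rdistrib mat)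
  show "w v* (M - mat \<mu>) = 0"
    using assms(2) by (simp add: vector_matrix_mult_diff_rdistrib mat)
qed

section \<open>Polynomials in a linear map, evaluated at one vector\<close>

definition poly_apply :: "(complex ^ 'p \<Rightarrow> complex ^ 'p) \<Rightarrow> complex poly \<Rightarrow> complex ^ 'p \<Rightarrow> complex ^ 'p"
  where "poly_apply T q w = (\<Sum>k\<le>degree q. coeff q k *s (T ^^ k) w)"

lemma poly_apply_bound:
  assumes "degree q \<le> N"
  shows "poly_apply T q w = (\<Sum>k\<le>N. coeff q k *s (T ^^ k) w)"
  unfolding poly_apply_def
  by (rule sum.mono_neutral_left) (use assms in \<open>auto simp: coeff_eq_0\<close>)

lemma linear_funpow:
  assumes "Vector_Spaces.linear (*s) (*s) (T :: complex ^ 'p \<Rightarrow> complex ^ 'p)"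
  shows "Vector_Spaces.linear (*s) (*s) (T ^^ k)"
proof (induction k)
  case 0
  show ?case using vec.linear_id by (simp add: id_def)
next
  case (Suc k)
  show ?case using Vector_Spaces.linear_compose[OF Suc assms] by (simp add: o_def)
qed

text \<open>A linear factor may act first or last. Acting first, it replaces the vector and leaves
  an annihilator of smaller degree; acting last, it exhibits an eigenvector equation for
  \<open>poly_apply T q w\<close>.\<close>

lemma poly_apply_factor:
  assumes T: "Vector_Spaces.linear (*s) (*s) T"
  shows "poly_apply T ([:- \<mu>, 1:] * q) w = poly_apply T q (T w - \<mu> *s w)"
    and "poly_apply T ([:- \<mu>, 1:] * q) w = T (poly_apply T q w) - \<mu> *s poly_apply T q w"
proof -
  have eq: "[:- \<mu>, 1:] * q = pCons 0 q - smult \<mu> q" by simp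
  \<comment> \<open>A common upper bound for the degrees is enough to split the sum, and it also
    covers \<open>q = 0\<close>.\<close>
  have "degree (pCons 0 q - smult \<mu> q) \<le> Suc (degree q)"
    by (intro degree_diff_le) (auto simp: degree_pCons_le intro: le_trans[OF degree_smult_le])
  then have "poly_apply T ([:- \<mu>, 1:] * q) w =
      (\<Sum>k\<le>Suc (degree q). coeff (pCons 0 q) k *s (T ^^ k) w)
      - \<mu> *s (\<Sum>k\<le>Suc (degree q). coeff q k *s (T ^^ k) w)"
    unfolding eq
    by (simp only: poly_apply_bound coeff_diff coeff_smult vec.scale_left_diff_distrib sum_subtractf
        vec.scale_sum_right vec.scale_scale)
  also have "(\<Sum>k\<le>Suc (degree q). coeff q k *s (T ^^ k) w) = poly_apply T q w"
    by (rule poly_apply_bound [symmetric]) simp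
  also have "(\<Sum>k\<le>Suc (degree q). coeff (pCons 0 q) k *s (T ^^ k) w) =
      (\<Sum>k\<le>degree q. coeff q k *s (T ^^ Suc k) w)"
    by (subst sum.atMost_Suc_shift) simp
  finally have main: "poly_apply T ([:- \<mu>, 1:] * q) w =
    (\<Sum>k\<le>degree q. coeff q k *s (T ^^ Suc k) w) - \<mu> *s poly_apply T q w" .
  show "poly_apply T ([:- \<mu>, 1:] * q) w = T (poly_apply T q w) - \<mu> *s poly_apply T q w"
    unfolding main by (simp add: poly_apply_def vec.linear_sum[OF T] vec.linear_scale[OF T])
  show "poly_apply T ([:- \<mu>, 1:] * q) w = poly_apply T q (T w - \<mu> *s w)"
    unfolding main
    by (simp add: poly_apply_def vec.linear_diff[OF linear_funpow[OF T]]
        vec.linear_scale[OF linear_funpow[OF T]] vec.scale_right_diff_distrib sum_subtractf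
        vec.scale_sum_right funpow_swap1 mult.commute)
qed

lemma real_dependence_sequence:
  fixes f :: "nat \<Rightarrow> 'a::euclidean_space"
  obtains c N k where "k \<le> N" "c k \<noteq> 0" "(\<Sum>k\<le>N. c k *\<^sub>R f k) = 0"
\<comment> \<open>Linear dependence speaks of sets, which forget repetitions; a repeated vector is
  therefore treated separately and gives the relation \<open>f i - f j = 0\<close>.\<close>
proof (cases "inj_on f {..DIM('a)}")
  case True
  have "card (f ` {..DIM('a)}) > DIM('a)" by (simp add: card_image[OF True])
  then have "dependent (f ` {..DIM('a)})" by (intro dependent_biggerset) simp
  then obtain u where u: "\<exists>v\<in>f ` {..DIM('a)}. u v \<noteq> 0" "(\<Sum>v\<in>f ` {..DIM('a)}. u v *\<^sub>R v) = 0"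
    by (auto simp: dependent_finite)
  then obtain k where "k \<le> DIM('a)" "u (f k) \<noteq> 0" by auto
  moreover have "(\<Sum>k\<le>DIM('a). (u \<circ> f) k *\<^sub>R f k) = 0"
    using u(2) by (simp add: sum.reindex[OF True])
  ultimately show ?thesis using that[of k "DIM('a)" "u \<circ> f"] by simp
next
  case False
  then obtain i j where ij: "i \<le> DIM('a)" "j \<le> DIM('a)" "i \<noteq> j" "f i = f j"
    by (auto simp: inj_on_def)
  define c :: "nat \<Rightarrow> real" where "c k = (if k = i then 1 else 0) - (if k = j then 1 else 0)" for k
  have "(\<Sum>k\<le>DIM('a). c k *\<^sub>R f k) = f i - f j"
    using ij by (simp add: c_def scaleR_left_diff_distrib sum_subtractf if_distrib[of "\<lambda>a. a *\<^sub>R _"]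
        cong: if_cong)
  then show ?thesis using that[of i "DIM('a)" c] ij by (simp add: c_def)
qed

lemma annihilating_poly:
  fixes w :: "complex ^ 'p"
  obtains q where "q \<noteq> 0" "poly_apply T q w = 0"
proof -
  \<comment> \<open>The complex vectors form a real Euclidean space, so the iterates of
    \<open>w\<close> satisfy a real relation; its coefficients are then read as complex
    numbers.\<close>
  obtain c :: "nat \<Rightarrow> real" and N k where
    c: "k \<le> N" "c k \<noteq> 0" "(\<Sum>k\<le>N. c k *\<^sub>R (T ^^ k) w) = 0"
    using real_dependence_sequence[of "\<lambda>k. (T ^^ k) w"] by metis
  define q :: "complex poly" where "q = (\<Sum>k\<le>N. monom (of_real (c k)) k)"
  have coeff: "coeff q k = (if k \<le> N then of_real (c k) else 0)" for k
    by (simp add: q_def coeff_sum)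
  have scale: "of_real a *s v = a *\<^sub>R v" for a and v :: "complex ^ 'p"
    by (simp add: vec_eq_iff) (simp add: scaleR_conv_of_real)
  have "q \<noteq> 0" using coeff[of k] c by auto
  moreover have "degree q \<le> N" by (rule degree_le) (simp add: coeff)
  then have "poly_apply T q w = (\<Sum>k\<le>N. c k *\<^sub>R (T ^^ k) w)"
    by (auto simp: poly_apply_bound coeff scale intro!: sum.cong)
  ultimately show ?thesis using that c(3) by simp
qed

text \<open>A substitute for the decomposition into generalized eigenspaces: the factors of an
  annihilating polynomial of \<open>w\<close> are removed one at a time.\<close>

lemma spectral_induct:
  fixes T :: "complex ^ 'p \<Rightarrow> complex ^ 'p"
  assumes T: "Vector_Spaces.linear (*s) (*s) T" and Q: "vec.subspace Q" "\<And>w. w \<in> Q \<Longrightarrow> T w \<in> Q"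
    and inj: "\<And>\<mu> w. \<not> E \<mu> \<Longrightarrow> w \<in> Q \<Longrightarrow> T w = \<mu> *s w \<Longrightarrow> w = 0"
    and zero: "S 0" and step: "\<And>\<mu> w. E \<mu> \<Longrightarrow> w \<in> Q \<Longrightarrow> S (T w - \<mu> *s w) \<Longrightarrow> S w"
    and w: "w \<in> Q"
  shows "S w"
proof -
  obtain q where "q \<noteq> 0" "poly_apply T q w = 0" using annihilating_poly by blast
  with w show ?thesis
  proof (induction "degree q" arbitrary: q w)
    case 0
    then obtain a where "q = [:a:]" by (metis degree_eq_zeroE)
    then show ?case using 0 zero by (auto simp: poly_apply_def)
  next
    case (Suc n)
    then obtain \<mu> where "poly q \<mu> = 0"
      using fundamental_theorem_of_algebra[of q] by (auto simp: constant_degree)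
    then obtain q' where q': "q = [:- \<mu>, 1:] * q'" by (metis dvdE poly_eq_0_iff_dvd)
    then have "q' \<noteq> 0" using Suc by auto
    then have deg: "n = degree q'" using Suc(2) by (simp add: q' degree_mult_eq del: mult_pCons_left)
    show ?case
    proof (cases "E \<mu>")
      case True
      \<comment> \<open>For a root in \<open>E\<close>, the cofactor \<open>q'\<close> annihilates
        \<open>T w - \<mu> *s w\<close>; the induction hypothesis holds there and
        \<open>step\<close> returns to \<open>w\<close>.\<close>
      have "T w - \<mu> *s w \<in> Q" using Q Suc.prems by (intro vec.subspace_diff vec.subspace_scale) auto
      moreover have "poly_apply T q' (T w - \<mu> *s w) = 0"
        using Suc.prems poly_apply_factor(1)[OF T] unfolding q' by metis
      ultimately have "S (T w - \<mu> *s w)" using Suc.hyps(1)[OF deg] \<open>q' \<noteq> 0\<close> by blast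
      then show ?thesis using step True Suc.prems by blast
    next
      case False
      \<comment> \<open>For a root outside \<open>E\<close>, the vector
        \<open>poly_apply T q' w\<close> satisfies the eigenvector equation inside \<open>Q\<close>,
        hence is zero: \<open>q'\<close> already annihilates \<open>w\<close>.\<close>
      have "(T ^^ k) w \<in> Q" for k using Suc.prems Q(2) by (induction k) auto
      then have "poly_apply T q' w \<in> Q"
        unfolding poly_apply_def using Q(1) by (intro vec.subspace_sum vec.subspace_scale)
      moreover have "T (poly_apply T q' w) = \<mu> *s poly_apply T q' w"
        using Suc.prems poly_apply_factor(2)[OF T] unfolding q' by (metis eq_iff_diff_eq_0)
      ultimately have "poly_apply T q' w = 0" using inj False by blast
      then show ?thesis using Suc.hyps(1)[OF deg] Suc.prems \<open>q' \<noteq> 0\<close> by blast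
    qed
  qed
qed

subsection \<open>Synchronization\<close>

theorem theorem1:
  fixes A :: "real ^ 'n ^ 'n" and B :: "real ^ 'm ^ 'n"
    and P :: "real ^ 'n ^ 'n" and K :: "real ^ 'n ^ 'm"
    and \<delta> :: real
    and \<Gamma> :: "real ^ 'p ^ 'p" and r :: "real ^ 'p"
    and x z :: "'p::finite \<Rightarrow> real \<Rightarrow> real ^ 'n" and u :: "'p \<Rightarrow> real \<Rightarrow> real ^ 'm"
    and xbar :: "real \<Rightarrow> real ^ 'n"
  assumes "stabilizable A B"
    and "sym_pos_def P"
    and "transpose A ** P + P ** A + mat 1 - P ** B ** transpose B ** P = 0"
    and "K = transpose B ** P"
    and "\<delta> > 0"
    and "connected_matrix \<Gamma>"
    and "\<And>\<mu>. eigenvalue (cmatrix \<Gamma>) \<mu> \<Longrightarrow> \<mu> \<noteq> 0 \<Longrightarrow> - Re \<mu> \<ge> \<delta>"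
    and "r v* \<Gamma> = 0" and "r \<bullet> 1 = 1"
    and "\<And>i t. t \<ge> 0 \<Longrightarrow> z i t = (\<Sum>j\<in>UNIV. \<Gamma> $ i $ j *\<^sub>R (x j t - x i t))"
    and "\<And>i t. t \<ge> 0 \<Longrightarrow> u i t = max 1 (inverse \<delta>) *\<^sub>R (K *v z i t)"
    and "\<And>i t. t \<ge> 0 \<Longrightarrow>
           (x i has_vector_derivative A *v x i t + B *v u i t) (at t within {0..})"
    and "\<And>t. t \<ge> 0 \<Longrightarrow>
           xbar t = unstack1 (kronecker (rowvector r :: real ^ 'p ^ 1) (matrix_exp (t *\<^sub>R A))
                               *v stack (\<lambda>i. x i 0))"
  shows "\<forall>i. ((\<lambda>t. norm (x i t - xbar t)) \<longlongrightarrow> 0) at_top"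
proof -

  \<comment> \<open>Weighted errors and their differential equations\<close>
  define c where "c = max 1 (inverse \<delta>)"
  define x0 where "x0 = (\<Sum>i\<in>UNIV. r $ i *\<^sub>R x i 0)"
  define e where "e i t = x i t - matrix_exp (t *\<^sub>R A) *v x0" for i t
  define E where "E w t = (\<Sum>i\<in>UNIV. w $ i *\<^sub>R e i t)" for w :: "real ^ 'p" and t
  have row: "(\<Sum>j\<in>UNIV. \<Gamma> $ i $ j) = 0" for i
    using assms(6) by (simp add: connected_matrix_def)
  have r1: "(\<Sum>i\<in>UNIV. r $ i) = 1"
    using assms(9) by (simp add: inner_vec_def)
  \<comment> \<open>The common trajectory cancels in the differences, and the zero row sum removes
    the term with \<open>e i t\<close>.\<close>
  have z: "z i t = (\<Sum>j\<in>UNIV. \<Gamma> $ i $ j *\<^sub>R e j t)" if "t \<ge> 0" for i t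
  proof -
    have "z i t = (\<Sum>j\<in>UNIV. \<Gamma> $ i $ j *\<^sub>R (e j t - e i t))"
      using assms(10)[OF that] by (simp add: e_def)
    also have "\<dots> = (\<Sum>j\<in>UNIV. \<Gamma> $ i $ j *\<^sub>R e j t) - (\<Sum>j\<in>UNIV. \<Gamma> $ i $ j) *\<^sub>R e i t"
      by (simp add: scaleR_diff_right sum_subtractf scaleR_sum_left)
    finally show ?thesis by (simp add: row)
  qed
  have E_lin: "E (v + w) t = E v t + E w t" "E (v - w) t = E v t - E w t"
    "E (a *\<^sub>R w) t = a *\<^sub>R E w t" for v w a t
    by (simp_all add: E_def scaleR_left_distrib scaleR_left_diff_distrib sum.distrib sum_subtractf
        scaleR_sum_right)
  have Ez: "(\<Sum>i\<in>UNIV. w $ i *\<^sub>R z i t) = E (w v* \<Gamma>) t" if "t \<ge> 0" for w t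
  proof -
    have "(\<Sum>i\<in>UNIV. w $ i *\<^sub>R z i t) = (\<Sum>i\<in>UNIV. \<Sum>j\<in>UNIV. (w $ i * \<Gamma> $ i $ j) *\<^sub>R e j t)"
      using that by (simp add: z scaleR_sum_right)
    also have "\<dots> = (\<Sum>j\<in>UNIV. \<Sum>i\<in>UNIV. (w $ i * \<Gamma> $ i $ j) *\<^sub>R e j t)" by (rule sum.swap)
    finally show ?thesis by (simp add: E_def vector_matrix_mult_def scaleR_sum_left)
  qed
  have dE: "(E w has_vector_derivative A *v E w t + B *v (K *v (c *\<^sub>R E (w v* \<Gamma>) t)))
      (at t within {0..})" if "t \<ge> 0" for w t
  proof -
    have "(E w has_vector_derivative (\<Sum>i\<in>UNIV. w $ i *\<^sub>R
        ((A *v x i t + B *v u i t) - A *v (matrix_exp (t *\<^sub>R A) *v x0)))) (at t within {0..})"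
      unfolding E_def e_def
      by (intro has_vector_derivative_sum has_vector_derivative_diff assms(12) that
          bounded_linear.has_vector_derivative[OF bounded_linear_scaleR_right]
          matrix_exp_vector_derivative)
    also have "(\<Sum>i\<in>UNIV. w $ i *\<^sub>R ((A *v x i t + B *v u i t) - A *v (matrix_exp (t *\<^sub>R A) *v x0))) =
        (\<Sum>i\<in>UNIV. A *v (w $ i *\<^sub>R e i t) + B *v (K *v (c *\<^sub>R (w $ i *\<^sub>R z i t))))"
      using assms(11)[OF that]
      by (intro sum.cong) (simp_all add: e_def c_def matrix_vector_mult_scaleR
          matrix_vector_mult_diff_distrib algebra_simps)
    also have "\<dots> = A *v E w t + B *v (K *v (c *\<^sub>R (\<Sum>i\<in>UNIV. w $ i *\<^sub>R z i t)))"
      by (simp add: sum.distrib E_def vec.linear_sum[OF matrix_vector_mul_linear_gen] scaleR_sum_right)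
    finally show ?thesis by (simp add: Ez[OF that])
  qed
  \<comment> \<open>Since \<open>r v* \<Gamma> = 0\<close>, the coupling drops out of the equation
    for \<open>E r\<close>; its initial value is zero because \<open>x0\<close> is the
    \<open>r\<close>-mean and the entries of \<open>r\<close> sum to one.\<close>
  have Er: "E r t = 0" if "t \<ge> 0" for t
  proof (rule linear_ode_unique_zero[of "(*v) A"])
    show "(E r has_vector_derivative A *v E r s) (at s within {0..})" if "s \<ge> 0" for s
    proof -
      have "E 0 s = 0" by (simp add: E_def)
      then show ?thesis using dE[OF that, of r] assms(8) by simp
    qed
    show "E r 0 = 0"
      by (simp add: E_def e_def matrix_exp_0 scaleR_diff_right sum_subtractf r1 x0_def
          flip: scaleR_sum_left)
  qed (use that in auto)

  \<comment> \<open>Complex weights and the spectral induction\<close>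
  define re where "re w = (\<chi> i. Re (w $ i))" for w :: "complex ^ 'p"
  define im where "im w = (\<chi> i. Im (w $ i))" for w :: "complex ^ 'p"
  define S where "S w \<longleftrightarrow> (E (re w) \<longlongrightarrow> 0) at_top \<and> (E (im w) \<longlongrightarrow> 0) at_top" for w
  have re_im_\<Gamma>: "re (w v* cmatrix \<Gamma>) = re w v* \<Gamma>" "im (w v* cmatrix \<Gamma>) = im w v* \<Gamma>" for w
    by (simp_all add: re_def im_def vector_matrix_mult_def vec_eq_iff)
  have re_im_smult: "re (v - \<mu> *s w) = re v - (Re \<mu> *\<^sub>R re w - Im \<mu> *\<^sub>R im w)"
    "im (v - \<mu> *s w) = im v - (Re \<mu> *\<^sub>R im w + Im \<mu> *\<^sub>R re w)" for v w \<mu>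
    by (simp_all add: re_def im_def vec_eq_iff)
  have S: "S w" if "w \<in> {w. (\<Sum>i\<in>UNIV. w $ i) = 0}" for w
  proof (rule spectral_induct[where T = "\<lambda>w. w v* cmatrix \<Gamma>" and S = S
        and E = "\<lambda>\<mu>. eigenvalue (cmatrix \<Gamma>) \<mu> \<and> \<mu> \<noteq> 0", OF _ _ _ _ _ _ that])
    show "Vector_Spaces.linear (*s) (*s) (\<lambda>w. w v* cmatrix \<Gamma>)"
      using matrix_vector_mul_linear_gen[of "transpose (cmatrix \<Gamma>)"]
      by (simp flip: transpose_matrix_vector)
    show "vec.subspace {w :: complex ^ 'p. (\<Sum>i\<in>UNIV. w $ i) = 0}"
      by (auto simp: vec.subspace_def sum.distrib simp flip: sum_distrib_left)
    \<comment> \<open>Invariance of the zero-sum weights is the zero row sum condition after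
      exchanging the two sums.\<close>
    show "w v* cmatrix \<Gamma> \<in> {w. (\<Sum>i\<in>UNIV. w $ i) = 0}" for w
    proof -
      have "(\<Sum>j\<in>UNIV. (w v* cmatrix \<Gamma>) $ j) =
          (\<Sum>j\<in>UNIV. \<Sum>i\<in>UNIV. w $ i * of_real (\<Gamma> $ i $ j))"
        by (simp add: vector_matrix_mult_def)
      also have "\<dots> = (\<Sum>i\<in>UNIV. \<Sum>j\<in>UNIV. w $ i * of_real (\<Gamma> $ i $ j))"
        by (rule sum.swap)
      also have "\<dots> = (\<Sum>i\<in>UNIV. w $ i * of_real (\<Sum>j\<in>UNIV. \<Gamma> $ i $ j))"
        by (simp add: sum_distrib_left)
      finally show ?thesis by (simp add: row)
    qed
    have "re 0 = 0" "im 0 = 0" by (simp_all add: re_def im_def vec_eq_iff)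
    moreover have "E 0 = (\<lambda>t. 0)" by (simp add: E_def fun_eq_iff)
    ultimately show "S 0" by (simp add: S_def)
  next
    fix \<mu> and w :: "complex ^ 'p"
    assume \<mu>: "\<not> (eigenvalue (cmatrix \<Gamma>) \<mu> \<and> \<mu> \<noteq> 0)" and w: "w \<in> {w. (\<Sum>i\<in>UNIV. w $ i) = 0}"
      and eq: "w v* cmatrix \<Gamma> = \<mu> *s w"
    \<comment> \<open>The eigenvalue 0 is excluded by connectedness, applied separately to the real
      and imaginary parts of \<open>w\<close>; any other excluded value is not an
      eigenvalue.\<close>
    show "w = 0"
    proof (cases "\<mu> = 0")
      case True
      then have "re w v* \<Gamma> = 0" "im w v* \<Gamma> = 0"
        using eq by (simp_all flip: re_im_\<Gamma>) (simp_all add: re_def im_def vec_eq_iff)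
      moreover have "(\<Sum>i\<in>UNIV. re w $ i) = 0" "(\<Sum>i\<in>UNIV. im w $ i) = 0"
        using w by (simp_all add: re_def im_def flip: Re_sum Im_sum)
      ultimately have "re w = 0" "im w = 0"
        by (auto intro: connected_matrix_left_kernel[OF assms(6) assms(8) r1])
      then show ?thesis by (simp add: re_def im_def vec_eq_iff complex_eq_iff)
    qed (use not_eigenvalue_left_trivial eq \<mu> in blast)
  next
    fix \<mu> and w :: "complex ^ 'p"
    assume \<mu>: "eigenvalue (cmatrix \<Gamma>) \<mu> \<and> \<mu> \<noteq> 0" and "S (w v* cmatrix \<Gamma> - \<mu> *s w)"
    moreover define s where "s = w v* cmatrix \<Gamma> - \<mu> *s w"
    ultimately have s: "(E (re s) \<longlongrightarrow> 0) at_top" "(E (im s) \<longlongrightarrow> 0) at_top"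
      by (simp_all add: S_def)
    have w\<Gamma>: "re w v* \<Gamma> = Re \<mu> *\<^sub>R re w - Im \<mu> *\<^sub>R im w + re s"
      "im w v* \<Gamma> = Re \<mu> *\<^sub>R im w + Im \<mu> *\<^sub>R re w + im s"
      by (simp_all add: s_def re_im_smult re_im_\<Gamma>)
    \<comment> \<open>This is where the gain \<open>max 1 (inverse \<delta>)\<close> enters: it
      pushes \<open>c * Re \<mu>\<close> down to at most -1, whereas -1/2 would suffice for the
      Lyapunov estimate.\<close>
    have "c * \<delta> \<ge> 1" using \<open>\<delta> > 0\<close> by (simp add: c_def max_def field_simps)
    moreover have "c * Re \<mu> \<le> c * (- \<delta>)"
      using assms(7)[of \<mu>] \<mu> by (intro mult_left_mono) (auto simp: c_def)
    ultimately have c\<mu>: "2 * (c * Re \<mu>) \<le> -1" by simp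
    have lim: "((\<lambda>t. B *v (K *v (c *\<^sub>R y t))) \<longlongrightarrow> 0) at_top" if "(y \<longlongrightarrow> 0) at_top"
      for y :: "real \<Rightarrow> real ^ 'n"
      using that
      by (intro bounded_linear.tendsto_zero[OF matrix_vector_mul_bounded_linear]
          bounded_linear.tendsto_zero[OF bounded_linear_scaleR_right])
    show "S w"
      unfolding S_def
    \<comment> \<open>The block has \<open>\<sigma> = c * Re \<mu>\<close> and
      \<open>\<omega> = c * Im \<mu>\<close>; its inputs come from \<open>s\<close> and vanish by
      the induction hypothesis.\<close>
    proof (rule riccati_block_tendsto_zero[OF assms(2-4) c\<mu> _ _ lim[OF s(1)] lim[OF s(2)]])
      fix t :: real assume "t \<ge> 0"
      show "(E (re w) has_vector_derivative A *v E (re w) t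
          + B *v (K *v ((c * Re \<mu>) *\<^sub>R E (re w) t - (c * Im \<mu>) *\<^sub>R E (im w) t))
          + B *v (K *v (c *\<^sub>R E (re s) t))) (at t within {0..})"
        using dE[OF \<open>t \<ge> 0\<close>, of "re w"]
        by (simp add: w\<Gamma> E_lin algebra_simps)
      show "(E (im w) has_vector_derivative A *v E (im w) t
          + B *v (K *v ((c * Re \<mu>) *\<^sub>R E (im w) t + (c * Im \<mu>) *\<^sub>R E (re w) t))
          + B *v (K *v (c *\<^sub>R E (im s) t))) (at t within {0..})"
        using dE[OF \<open>t \<ge> 0\<close>, of "im w"]
        by (simp add: w\<Gamma> E_lin algebra_simps)
    qed
  qed

  \<comment> \<open>Convergence of the individual systems\<close>
  show ?thesis
  proof
    fix i
    \<comment> \<open>Subtracting \<open>r\<close> from the unit weight makes the sum zero, and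
      \<open>E r = 0\<close> means that nothing is lost: the weighted error is still
      \<open>e i\<close>.\<close>
    define w :: "complex ^ 'p" where "w = (\<chi> j. of_real ((axis i 1 - r) $ j))"
    have "(\<Sum>j\<in>UNIV. (axis i 1 - r) $ j) = 0"
      using r1 by (simp add: sum_subtractf axis_def)
    then have "(\<Sum>j\<in>UNIV. w $ j) = 0"
      by (simp only: w_def vec_lambda_beta flip: of_real_sum) simp
    then have "S w" using S by simp
    moreover have "re w = axis i 1 - r" by (simp add: re_def w_def vec_eq_iff)
    ultimately have "(E (axis i 1 - r) \<longlongrightarrow> 0) at_top" by (simp add: S_def)
    moreover have "\<forall>\<^sub>F t in at_top. E (axis i 1 - r) t = x i t - xbar t"
      using eventually_ge_at_top[of 0]
    proof eventually_elim
      case (elim t)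
      have "E (axis i 1) t = e i t"
        by (simp add: E_def axis_def if_distrib[of "\<lambda>a. a *\<^sub>R _"] cong: if_cong)
      moreover have "xbar t = matrix_exp (t *\<^sub>R A) *v x0"
        using assms(13)[OF elim] by (simp add: unstack1_kronecker_rowvector x0_def)
      ultimately show ?case by (simp add: E_lin Er[OF elim] e_def)
    qed
    ultimately have "((\<lambda>t. x i t - xbar t) \<longlongrightarrow> 0) at_top"
      by (rule Lim_transform_eventually)
    then show "((\<lambda>t. norm (x i t - xbar t)) \<longlongrightarrow> 0) at_top"
      by (rule tendsto_norm_zero)
  qed
qed

end
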